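(* Let $a_1,a_2>0$. For all integers $n_1,n_2\ge 0$, the multiple Charlier polynomials fulfill the inversion formula $$x^{(n_1+n_2,1)}=\sum_{k=0}^{n_1}\sum_{\ell=0}^{n_2}\binom{n_1}{k}\binom{n_2}{\ell}a_1^{\,n_1-k}a_2^{\,n_2-\ell}\,C_{k,\ell}^{(a_1,a_2)}(x).$$
   Context: For an integer $n\ge 0$, $x^{(n,1)}=x(x-1)\cdots(x-n+1)$ denotes the falling factorial, with $x^{(0,1)}=1$. For parameters $a_1,a_2>0$ and integers $n_1,n_2\ge 0$, the multiple Charlier polynomials (for $r=2$ weights $a_i^x/\Gamma(x+1)$, $x=0,1,2,\ldots$) are given by $$C_{n_1,n_2}^{(a_1,a_2)}(x)=\sum_{k=0}^{n_1}\sum_{\ell=0}^{n_2}\binom{n_1}{k}\binom{n_2}{\ell}(-a_1)^{n_1-k}(-a_2)^{n_2-\ell}\,x^{(k+\ell,1)}.$$ *)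

theory Defs
  imports Complex_Main
begin

text \<open>
  The falling factorial $x(x-1)\cdots(x-n+1)$; the empty product gives the value 1 for $n=0$.
\<close>

definition ffact :: "nat \<Rightarrow> 'a::comm_ring_1 \<Rightarrow> 'a" where
  "ffact n x = (\<Prod>i<n. x - of_nat i)"

text \<open>
  The parameters are real; the argument ranges over an arbitrary real field, so that real and
  complex arguments are both covered.
\<close>

definition multiple_charlier :: "real \<Rightarrow> real \<Rightarrow> nat \<Rightarrow> nat \<Rightarrow> 'a::real_field \<Rightarrow> 'a" where
  "multiple_charlier a1 a2 n1 n2 x =
     (\<Sum>k=0..n1. \<Sum>l=0..n2. of_nat (n1 choose k) * of_nat (n2 choose l) *
        of_real ((- a1) ^ (n1 - k)) * of_real ((- a2) ^ (n2 - l)) * ffact (k + l) x)"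

end

theory Submission
  imports Defs
begin

text \<open>
  In umbral terms, the binomial transform with parameter \<open>b\<close> sends a sequence \<open>f\<close> to
  \<open>n \<mapsto> (E + b)\<^sup>n f 0\<close>, where \<open>E\<close> is the shift. Hence transforms with parameters \<open>a\<close> and \<open>b\<close>
  compose to the one with parameter \<open>a + b\<close>, and those with parameters \<open>a\<close> and \<open>- a\<close> are inverse to
  each other. The multiple Charlier polynomials arise from \<open>(i, j) \<mapsto> ffact (i + j) x\<close> by applying
  such a transform in each index separately; transforms in different indices commute, so they can be
  undone one at a time.
\<close>

definition binomial_transform :: "'a::comm_ring_1 \<Rightarrow> (nat \<Rightarrow> 'a) \<Rightarrow> nat \<Rightarrow> 'a" where
  "binomial_transform b f n = (\<Sum>k\<le>n. of_nat (n choose k) * b ^ (n - k) * f k)"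

lemma binomial_transform_0_right [simp]: "binomial_transform b f 0 = f 0"
  by (simp add: binomial_transform_def)

text \<open>Pascal's rule, umbrally \<open>(E + b)^(n+1) = (E + b)^n E + b (E + b)^n\<close>; it
  drives the inductions below.\<close>

lemma binomial_transform_Suc:
  "binomial_transform b f (Suc n) =
     binomial_transform b (\<lambda>k. f (Suc k)) n + b * binomial_transform b f n"
proof -
  have "b * binomial_transform b f n = (\<Sum>k\<le>n. of_nat (n choose k) * b ^ (Suc n - k) * f k)"
    by (simp add: binomial_transform_def sum_distrib_left Suc_diff_le algebra_simps)
  \<comment> \<open>The new term has coefficient \<open>n choose Suc n = 0\<close>;
    \<open>k = 0\<close> can now be split off.\<close>
  also have "\<dots> = (\<Sum>k\<le>Suc n. of_nat (n choose k) * b ^ (Suc n - k) * f k)"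
    by (simp add: binomial_eq_0)
  also have "\<dots> = b ^ Suc n * f 0 + (\<Sum>k\<le>n. of_nat (n choose Suc k) * b ^ (n - k) * f (Suc k))"
    by (subst sum.atMost_Suc_shift) simp
  finally show ?thesis
    by (simp add: binomial_transform_def sum.atMost_Suc_shift sum.distrib algebra_simps
        del: sum.atMost_Suc)
qed

lemma binomial_transform_add:
  "binomial_transform b (\<lambda>k. f k + g k) n = binomial_transform b f n + binomial_transform b g n"
  by (simp add: binomial_transform_def sum.distrib algebra_simps)

lemma binomial_transform_cmult:
  "binomial_transform b (\<lambda>k. c * f k) n = c * binomial_transform b f n"
  by (simp add: binomial_transform_def sum_distrib_left algebra_simps)

lemma binomial_transform_compose:
  "binomial_transform a (binomial_transform b f) n = binomial_transform (a + b) f n"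
  \<comment> \<open>The recursion shifts \<open>f\<close>, so \<open>f\<close> must vary.\<close>
  by (induction n arbitrary: f)
    (simp_all add: binomial_transform_Suc binomial_transform_add binomial_transform_cmult
      algebra_simps)

lemma binomial_transform_0_left: "binomial_transform 0 f n = f n"
  by (induction n arbitrary: f) (simp_all add: binomial_transform_Suc)

lemma binomial_inversion: "binomial_transform a (binomial_transform (- a) f) n = f n"
  by (simp add: binomial_transform_compose binomial_transform_0_left)

lemma binomial_transform_commute:
  "binomial_transform b (\<lambda>j. binomial_transform c (\<lambda>i. h i j) m) n =
     binomial_transform c (\<lambda>i. binomial_transform b (h i) n) m"
  unfolding binomial_transform_def sum_distrib_left
  by (subst sum.swap) (simp add: algebra_simps)

lemma multiple_charlier_eq_binomial_transform:
  "multiple_charlier a1 a2 n1 n2 x =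
     binomial_transform (- of_real a1)
       (\<lambda>i. binomial_transform (- of_real a2) (\<lambda>j. ffact (i + j) x) n2) n1"
  by (simp add: multiple_charlier_def binomial_transform_def atMost_atLeast0 sum_distrib_left
      algebra_simps)

theorem theorem3:
  fixes a1 a2 :: real and n1 n2 :: nat and x :: "'a::real_field"
  assumes "a1 > 0" and "a2 > 0"
  shows "ffact (n1 + n2) x =
     (\<Sum>k=0..n1. \<Sum>l=0..n2. of_nat (n1 choose k) * of_nat (n2 choose l) *
        of_real (a1 ^ (n1 - k)) * of_real (a2 ^ (n2 - l)) * multiple_charlier a1 a2 k l x)"
proof -
  let ?T1 = "binomial_transform (of_real a1 :: 'a)"
  let ?T2 = "binomial_transform (of_real a2 :: 'a)"
  \<comment> \<open>Swapping \<open>?T2\<close> past the \<open>- a1\<close> transform makes the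
    inverse pairs adjacent: one cancels in each index.\<close>
  have "ffact (n1 + n2) x = ?T1 (\<lambda>k. ?T2 (\<lambda>l. multiple_charlier a1 a2 k l x) n2) n1"
    unfolding multiple_charlier_eq_binomial_transform
      binomial_transform_commute[of "of_real a2" "- of_real a1"] binomial_inversion ..
  also have "\<dots> = (\<Sum>k=0..n1. \<Sum>l=0..n2. of_nat (n1 choose k) * of_nat (n2 choose l) *
        of_real (a1 ^ (n1 - k)) * of_real (a2 ^ (n2 - l)) * multiple_charlier a1 a2 k l x)"
    by (simp add: binomial_transform_def atMost_atLeast0 sum_distrib_left algebra_simps)
  finally show ?thesis .
qed

end
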